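(* Let $n\ge 2$, let $\varphi\in\Phi_2$ be such that $J_\varphi^\circ\ne[-1,1]^2$, and let $\psi_1,\psi_2\in\Phi$ be such that $$J_\varphi^\circ\cap[0,\infty)^2=\{(x_1,x_2)\in[0,1]^2:\psi_1(x_1)+\psi_2(x_2)\le 1\}.$$ For $j=1,2$ let $\tau_j=\max\{t\ge 0:\psi_j(t)=0\}<1$ and let $\widehat{\psi_j}:[\tau_j,1]\to[0,1]$ be the restriction of $\psi_j$ to $[\tau_j,1]$ (a bijection). If $K,L$ are compact convex sets in $\mathbb{R}^n$ containing the origin, then the set $$\{\widehat{\psi_1}^{-1}(1-t)x+\widehat{\psi_2}^{-1}(t)y:x\in K,\ y\in L,\ 0\le t\le 1\}$$ equals the Orlicz sum $K+_\varphi L$, i.e. the compact convex set with support function $h_{K+_\varphi L}(x)=\inf\{\lambda>0:\varphi(h_K(x)/\lambda,h_L(x)/\lambda)\le 1\}$, $x\in\mathbb{R}^n$.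
   Context: $\Phi_m$ is the set of convex functions $\varphi:[0,\infty)^m\to[0,\infty)$ that are increasing (i.e. nondecreasing) in each variable and satisfy $\varphi(o)=0$ and $\varphi(e_j)=1$, $j=1,\dots,m$, where $e_1,\dots,e_m$ is the standard basis; $\Phi=\Phi_1$. For $\varphi\in\Phi_2$, $J_\varphi=\{(x_1,x_2)\in[-1,1]^2:\varphi(|x_1|,|x_2|)\le 1\}$, a convex body symmetric with respect to both coordinate axes. The polar of $J$ is $J^\circ=\{x:x\cdot y\le 1\text{ for all }y\in J\}$, and $h_K(x)=\sup\{x\cdot y:y\in K\}$ is the support function. (When $J_\varphi^\circ\ne[-1,1]^2$, such $\psi_1,\psi_2\in\Phi$ always exist.) *)

theory Defs
  imports "HOL-Analysis.Analysis"
begin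

text \<open>
  The class \<open>\<Phi>\<^sub>m\<close>, with \<open>Basis\<close> as the standard basis \<open>e\<^sub>1, \<dots>, e\<^sub>m\<close>: the type
  \<open>real \<times> real\<close> gives \<open>\<Phi>\<^sub>2\<close> and the type \<open>real\<close> (where \<open>Basis = {1}\<close>) gives
  \<open>\<Phi> = \<Phi>\<^sub>1\<close>. Functions are total; only their values on the orthant are
  constrained or used.
\<close>

definition orthant :: "'a::euclidean_space set" where
  "orthant = {x. \<forall>b\<in>Basis. 0 \<le> x \<bullet> b}"

definition Phi :: "('a::euclidean_space \<Rightarrow> real) set" where
  "Phi = {\<phi>. convex_on orthant \<phi>
             \<and> (\<forall>x\<in>orthant. 0 \<le> \<phi> x)
             \<and> (\<forall>x\<in>orthant. \<forall>b\<in>Basis. \<forall>s\<ge>0. \<phi> x \<le> \<phi> (x + s *\<^sub>R b))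
             \<and> \<phi> 0 = 0
             \<and> (\<forall>b\<in>Basis. \<phi> b = 1)}"

definition orlicz_body :: "(real \<times> real \<Rightarrow> real) \<Rightarrow> (real \<times> real) set" where
  "orlicz_body \<phi> = {(x1, x2). x1 \<in> {-1..1} \<and> x2 \<in> {-1..1} \<and> \<phi> (\<bar>x1\<bar>, \<bar>x2\<bar>) \<le> 1}"

definition polar :: "'a::real_inner set \<Rightarrow> 'a set" where
  "polar J = {x. \<forall>y\<in>J. x \<bullet> y \<le> 1}"

definition support_fun :: "'a::real_inner set \<Rightarrow> 'a \<Rightarrow> real" where
  "support_fun K x = (SUP y\<in>K. x \<bullet> y)"

text \<open>
  The Orlicz sum is the nonempty compact convex set with the prescribed support
  function. Nonemptiness is explicit because \<open>support_fun {}\<close> is a meaningless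
  supremum over the empty set of reals.
\<close>

definition is_orlicz_sum ::
  "(real \<times> real \<Rightarrow> real) \<Rightarrow> 'a::euclidean_space set \<Rightarrow> 'a set \<Rightarrow> 'a set \<Rightarrow> bool" where
  "is_orlicz_sum \<phi> K L M \<longleftrightarrow>
     M \<noteq> {} \<and> compact M \<and> convex M \<and>
     (\<forall>x. support_fun M x =
            Inf {r. r > 0 \<and> \<phi> (support_fun K x / r, support_fun L x / r) \<le> 1})"

definition orlicz_sum ::
  "(real \<times> real \<Rightarrow> real) \<Rightarrow> 'a::euclidean_space set \<Rightarrow> 'a set \<Rightarrow> 'a set" where
  "orlicz_sum \<phi> K L = (THE M. is_orlicz_sum \<phi> K L M)"

text \<open>\<open>GREATEST\<close> rather than \<open>Max\<close>, since the zero set need not be finite.\<close>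

definition tau :: "(real \<Rightarrow> real) \<Rightarrow> real" where
  "tau \<psi> = (GREATEST t. 0 \<le> t \<and> \<psi> t = 0)"

text \<open>The inverse of the restriction of \<open>\<psi>\<close> to \<open>[tau \<psi>, 1]\<close>, a bijection onto \<open>[0, 1]\<close>.\<close>

definition psi_hat_inv :: "(real \<Rightarrow> real) \<Rightarrow> real \<Rightarrow> real" where
  "psi_hat_inv \<psi> = inv_into {tau \<psi>..1} \<psi>"

end

theory Submission
  imports Defs
begin

text \<open>
  Let \<open>P = J\<^sub>\<phi>\<^sup>\<circ> \<inter> [0,\<infinity>)\<^sup>2\<close>. The arc \<open>\<psi>\<^sub>1(u) + \<psi>\<^sub>2(v) = 1\<close> dominates every point of \<open>P\<close>
  coordinatewise, and \<open>K\<close>, \<open>L\<close> are star-shaped about the origin, so the set in question is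
  \<open>{u x + v y | (u, v) \<in> P, x \<in> K, y \<in> L}\<close>. That set is compact and convex because \<open>P\<close>, \<open>K\<close> and
  \<open>L\<close> are, and its support function at \<open>z\<close> is the support function of \<open>P\<close> at
  \<open>(h\<^sub>K(z), h\<^sub>L(z))\<close>. By separation the latter is the gauge of \<open>J\<^sub>\<phi>\<close>, which is the defining
  infimum of the Orlicz sum.
\<close>

section \<open>Support functions and uniqueness of the Orlicz sum\<close>

lemma inner_le_support_fun:
  fixes K :: "'a::euclidean_space set"
  assumes "compact K" "y \<in> K"
  shows "x \<bullet> y \<le> support_fun K x"
  unfolding support_fun_def
proof (rule cSUP_upper[OF assms(2)])
  have "compact ((\<lambda>y. x \<bullet> y) ` K)"
    by (intro compact_continuous_image continuous_intros assms)
  then show "bdd_above ((\<lambda>y. x \<bullet> y) ` K)"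
    by (intro bounded_imp_bdd_above compact_imp_bounded)
qed

lemma support_fun_attained:
  fixes K :: "'a::euclidean_space set"
  assumes "compact K" "K \<noteq> {}"
  obtains y where "y \<in> K" "support_fun K x = x \<bullet> y"
proof -
  obtain y where y: "y \<in> K" "\<And>z. z \<in> K \<Longrightarrow> x \<bullet> z \<le> x \<bullet> y"
    using continuous_attains_sup[OF assms, of "\<lambda>y. x \<bullet> y"] continuous_on_inner[of K "\<lambda>_. x" "\<lambda>y. y"]
    by auto
  have "support_fun K x \<le> x \<bullet> y"
    unfolding support_fun_def using y assms by (intro cSUP_least) auto
  with inner_le_support_fun[OF assms(1) y(1), of x] y(1) that show thesis by fastforce
qed

lemma support_fun_nonneg:
  fixes K :: "'a::euclidean_space set"
  assumes "compact K" "0 \<in> K"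
  shows "0 \<le> support_fun K x"
  using inner_le_support_fun[OF assms, of x] by simp

text \<open>A point of \<open>M\<close> outside \<open>N\<close> would be strictly separated from
  \<open>N\<close> by a hyperplane with normal \<open>a\<close>. Since \<open>N\<close> lies on the
  larger side, the support functions violate the inequality in direction \<open>-a\<close>.\<close>

lemma support_fun_le_imp_subset:
  fixes M N :: "'a::euclidean_space set"
  assumes "compact M" "compact N" "convex N" "N \<noteq> {}"
    and le: "\<And>x. support_fun M x \<le> support_fun N x"
  shows "M \<subseteq> N"
proof
  fix z assume z: "z \<in> M"
  show "z \<in> N"
  proof (rule ccontr)
    assume "z \<notin> N"
    then obtain a b where ab: "a \<bullet> z < b" "\<And>y. y \<in> N \<Longrightarrow> b < a \<bullet> y"
      using separating_hyperplane_closed_point[OF assms(3)] compact_imp_closed[OF assms(2)] by metis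
    obtain y where y: "y \<in> N" "support_fun N (-a) = (-a) \<bullet> y"
      using support_fun_attained assms(2,4) by blast
    have "(-a) \<bullet> z \<le> (-a) \<bullet> y"
      using inner_le_support_fun[OF assms(1) z, of "-a"] le[of "-a"] y(2) by linarith
    with ab(1) ab(2)[OF y(1)] show False by simp
  qed
qed

text \<open>Two candidates have the same support function, so the preceding inclusion applies in
  both directions. This is what gives the definite description a value.\<close>

lemma orlicz_sum_eqI:
  assumes "is_orlicz_sum \<phi> K L M"
  shows "orlicz_sum \<phi> K L = M"
  unfolding orlicz_sum_def
proof (rule the_equality[where P = "is_orlicz_sum \<phi> K L", OF assms])
  fix N assume N: "is_orlicz_sum \<phi> K L N"
  show "N = M"
    using assms N unfolding is_orlicz_sum_def
    by (intro antisym support_fun_le_imp_subset) auto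
qed

section \<open>Elementary properties of orthants, polars and the Orlicz body\<close>

lemma closed_orthant: "closed (orthant :: 'a::euclidean_space set)"
proof -
  have "orthant = (\<Inter>b\<in>Basis. {x::'a. 0 \<le> x \<bullet> b})" by (auto simp: orthant_def)
  also have "closed \<dots>"
    by (intro closed_INT ballI closed_Collect_le continuous_intros)
  finally show ?thesis .
qed

lemma convex_orthant: "convex (orthant :: 'a::euclidean_space set)"
  unfolding convex_def orthant_def by (auto simp: inner_add_left)

lemma orthant_Pair: "((a::real), (b::real)) \<in> orthant \<longleftrightarrow> 0 \<le> a \<and> 0 \<le> b"
  by (auto simp: orthant_def Basis_prod_def)

lemma orthant_real: "(orthant :: real set) = {0..}"
  by (auto simp: orthant_def)

lemma closed_polar: "closed (polar (J :: 'a::euclidean_space set))"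
proof -
  have "polar J = (\<Inter>y\<in>J. {x. x \<bullet> y \<le> 1})" by (auto simp: polar_def)
  also have "closed \<dots>"
    by (intro closed_INT ballI closed_Collect_le continuous_intros)
  finally show ?thesis .
qed

lemma convex_polar: "convex (polar (J :: 'a::euclidean_space set))"
proof -
  have "polar J = (\<Inter>y\<in>J. {x. y \<bullet> x \<le> 1})" by (auto simp: polar_def inner_commute)
  also have "convex \<dots>" by (intro convex_INT convex_halfspace_le)
  finally show ?thesis .
qed

lemma Phi_mono_Pair:
  fixes \<phi> :: "real \<times> real \<Rightarrow> real"
  assumes "\<phi> \<in> Phi" "0 \<le> a" "a \<le> a'" "0 \<le> b" "b \<le> b'"
  shows "\<phi> (a, b) \<le> \<phi> (a', b')"
proof -
  have m: "\<And>x e s. x \<in> orthant \<Longrightarrow> e \<in> Basis \<Longrightarrow> 0 \<le> s \<Longrightarrow> \<phi> x \<le> \<phi> (x + s *\<^sub>R e)"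
    using assms(1) by (auto simp: Phi_def)
  have "\<phi> (a, b) \<le> \<phi> (a', b)"
    using m[of "(a, b)" "(1, 0)" "a' - a"] assms by (auto simp: orthant_Pair Basis_prod_def)
  also have "\<dots> \<le> \<phi> (a', b')"
    using m[of "(a', b)" "(0, 1)" "b' - b"] assms by (auto simp: orthant_Pair Basis_prod_def)
  finally show ?thesis .
qed

lemma Phi_le_scaleR:
  fixes \<phi> :: "'a::euclidean_space \<Rightarrow> real"
  assumes "\<phi> \<in> Phi" "x \<in> orthant" "0 \<le> s" "s \<le> 1"
  shows "\<phi> (s *\<^sub>R x) \<le> s * \<phi> x"
proof -
  have "convex_on orthant \<phi>" "\<phi> 0 = 0" "(0::'a) \<in> orthant"
    using assms(1) by (auto simp: Phi_def orthant_def)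
  then show ?thesis
    using convex_onD[of orthant \<phi> s 0 x] assms by auto
qed

text \<open>The box constraint is automatic: convexity with values 0 at the origin and 1 at a basis
  vector makes \<phi> grow at least linearly beyond that vector, and monotonicity carries this bound
  from the axes to \<open>(a, b)\<close>.\<close>

lemma mem_orlicz_body_nonneg:
  assumes "\<phi> \<in> Phi" "0 \<le> a" "0 \<le> b"
  shows "(a, b) \<in> orlicz_body \<phi> \<longleftrightarrow> \<phi> (a, b) \<le> 1"
proof -
  have one: "\<phi> (1, 0) = 1" "\<phi> (0, 1) = 1"
    using assms(1) by (auto simp: Phi_def Basis_prod_def)
  have "a \<le> 1" if le: "\<phi> (a, b) \<le> 1"
  proof (rule ccontr)
    assume a: "\<not> a \<le> 1"
    have "\<phi> ((1/a) *\<^sub>R (a, 0)) \<le> (1/a) * \<phi> (a, 0)"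
      using a by (intro Phi_le_scaleR[OF assms(1)]) (auto simp: orthant_Pair)
    with a one have "a \<le> \<phi> (a, 0)" by (simp add: field_simps)
    also have "\<dots> \<le> \<phi> (a, b)" using assms by (intro Phi_mono_Pair[OF assms(1)]) auto
    finally show False using le a by simp
  qed
  moreover have "b \<le> 1" if le: "\<phi> (a, b) \<le> 1"
  proof (rule ccontr)
    assume b: "\<not> b \<le> 1"
    have "\<phi> ((1/b) *\<^sub>R (0, b)) \<le> (1/b) * \<phi> (0, b)"
      using b by (intro Phi_le_scaleR[OF assms(1)]) (auto simp: orthant_Pair)
    with b one have "b \<le> \<phi> (0, b)" by (simp add: field_simps)
    also have "\<dots> \<le> \<phi> (a, b)" using assms by (intro Phi_mono_Pair[OF assms(1)]) auto
    finally show False using le b by simp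
  qed
  ultimately show ?thesis
    using assms by (auto simp: orlicz_body_def)
qed

text \<open>Stands in for continuity of \<phi>. Points of the sublevel set converging to
  \<open>(a, b)\<close> eventually dominate the shrunken point \<open>(s * a, s * b)\<close>
  coordinatewise, and monotonicity does the rest.\<close>

lemma closure_orlicz_body_scaled:
  fixes \<phi> :: "real \<times> real \<Rightarrow> real"
  assumes \<phi>: "\<phi> \<in> Phi" and s: "0 \<le> s" "s < 1"
    and x: "(a, b) \<in> closure {x \<in> orthant. \<phi> x \<le> 1}"
  shows "\<phi> (s * a, s * b) \<le> 1"
proof -
  obtain X :: "nat \<Rightarrow> real \<times> real" where X: "\<And>n. X n \<in> {x \<in> orthant. \<phi> x \<le> 1}" and lim: "X \<longlonglongrightarrow> (a, b)"
    using x unfolding closure_sequential by blast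
  have nn: "0 \<le> fst (X n)" "0 \<le> snd (X n)" "\<phi> (fst (X n), snd (X n)) \<le> 1" for n
    using X[of n] by (auto simp: orthant_Pair[of "fst (X n)" "snd (X n)", unfolded prod.collapse])
  have limf: "(\<lambda>n. fst (X n)) \<longlonglongrightarrow> a" and lims: "(\<lambda>n. snd (X n)) \<longlonglongrightarrow> b"
    using tendsto_fst[OF lim] tendsto_snd[OF lim] by auto
  have a: "0 \<le> a" and b: "0 \<le> b"
    using nn LIMSEQ_le_const[OF limf, of 0] LIMSEQ_le_const[OF lims, of 0] by auto
  \<comment> \<open>The strict inequality \<open>s * c < c\<close> fails at \<open>c = 0\<close>;
    there nonnegativity of the sequence suffices.\<close>
  have ev: "\<forall>\<^sub>F n in sequentially. s * c \<le> f n"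
    if "f \<longlonglongrightarrow> c" "0 \<le> c" "\<And>n. 0 \<le> f n" for f :: "nat \<Rightarrow> real" and c
  proof (cases "c = 0")
    case False
    then have "s * c < c" using that s by simp
    from order_tendstoD(1)[OF that(1) this] show ?thesis
      by (rule eventually_mono) simp
  qed (use that in simp)
  have "\<forall>\<^sub>F n in sequentially. s * a \<le> fst (X n) \<and> s * b \<le> snd (X n)"
    using ev[OF limf a] ev[OF lims b] nn by (auto intro: eventually_conj)
  then obtain n where n: "s * a \<le> fst (X n)" "s * b \<le> snd (X n)"
    using eventually_happens'[OF sequentially_bot] by blast
  have "\<phi> (s * a, s * b) \<le> \<phi> (fst (X n), snd (X n))"
    using n a b s by (intro Phi_mono_Pair[OF \<phi>]) auto
  with nn(3)[of n] show ?thesis by simp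
qed

section \<open>Duality: the polar's support function as the gauge of the Orlicz body\<close>

text \<open>The nontrivial half of the bipolar theorem. As the origin lies in \<open>S\<close>, the
  separating threshold \<open>b\<close> is negative; dividing by it reverses the inequalities and
  normalises the threshold to 1.\<close>

lemma closed_convex_separate_le_1:
  fixes S :: "'a::euclidean_space set"
  assumes "closed S" "convex S" "0 \<in> S" "x \<notin> S"
  obtains w where "1 < w \<bullet> x" "\<And>y. y \<in> S \<Longrightarrow> w \<bullet> y \<le> 1"
proof -
  obtain a b where ab: "a \<bullet> x < b" "\<And>y. y \<in> S \<Longrightarrow> b < a \<bullet> y"
    using separating_hyperplane_closed_point[OF assms(2,1,4)] by blast
  have b: "b < 0" using ab(2)[OF assms(3)] by simp
  show thesis
  proof (rule that[of "(1/b) *\<^sub>R a"])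
    show "1 < (1/b) *\<^sub>R a \<bullet> x" using ab(1) b by (simp add: field_simps)
    show "(1/b) *\<^sub>R a \<bullet> y \<le> 1" if "y \<in> S" for y
      using ab(2)[OF that] b by (simp add: field_simps)
  qed
qed

text \<open>Pairing with the basis vectors, which belong to the Orlicz body, confines this closed
  set to the unit square.\<close>

lemma compact_polar_orlicz_body:
  assumes \<phi>: "\<phi> \<in> Phi"
  shows "compact (polar (orlicz_body \<phi>) \<inter> orthant)"
proof -
  have one: "\<phi> (1, 0) = 1" "\<phi> (0, 1) = 1"
    using \<phi> by (auto simp: Phi_def Basis_prod_def)
  have mem: "(1, 0) \<in> orlicz_body \<phi>" "(0, 1) \<in> orlicz_body \<phi>"
    using one by (auto simp: mem_orlicz_body_nonneg[OF \<phi>])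
  have "polar (orlicz_body \<phi>) \<inter> orthant \<subseteq> {0..1} \<times> {0..1}"
    using mem by (fastforce simp: polar_def orthant_Pair)
  moreover have "bounded ({0..1} \<times> {0..1} :: (real \<times> real) set)"
    by (intro bounded_Times) auto
  ultimately show ?thesis
    by (auto simp: compact_eq_bounded_closed closed_Int closed_polar closed_orthant
        intro: bounded_subset)
qed

text \<open>An admissible \<open>r\<close> puts \<open>(a / r, b / r)\<close> in the Orlicz body and
  hence bounds the support function; conversely, separation shows that every \<open>r\<close> above
  the support function is admissible. So the infimum is squeezed, attained or not.\<close>

lemma support_fun_polar_orlicz_body:
  assumes \<phi>: "\<phi> \<in> Phi" and a: "0 \<le> a" and b: "0 \<le> b"
  shows "support_fun (polar (orlicz_body \<phi>) \<inter> orthant) (a, b) = Inf {r. r > 0 \<and> \<phi> (a / r, b / r) \<le> 1}"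
proof -
  let ?P = "polar (orlicz_body \<phi>) \<inter> orthant"
  let ?S = "support_fun ?P (a, b)"
  let ?R = "{r. r > 0 \<and> \<phi> (a / r, b / r) \<le> 1}"
  have cP: "compact ?P" by (rule compact_polar_orlicz_body[OF \<phi>])
  have P0: "0 \<in> ?P" by (auto simp: polar_def orthant_def)
  have S0: "0 \<le> ?S" by (rule support_fun_nonneg[OF cP P0])
  have lower: "?S \<le> r" if "r \<in> ?R" for r
  proof -
    have "(a / r, b / r) \<in> orlicz_body \<phi>"
      using that a b by (simp add: mem_orlicz_body_nonneg[OF \<phi>])
    then have "(a, b) \<bullet> p \<le> r" if "p \<in> ?P" for p
      using that \<open>r \<in> ?R\<close> by (cases p) (auto simp: polar_def field_simps)
    then show ?thesis
      unfolding support_fun_def using P0 by (intro cSUP_least) auto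
  qed
  have upper: "r \<in> ?R" if r: "?S < r" for r
  proof -
    \<comment> \<open>The separation argument only reaches the closure of the sublevel set, at scale
      \<open>r'\<close>. The gap between \<open>r'\<close> and \<open>r\<close> supplies the factor
      \<open>r' / r < 1\<close> that recovers the bound on \<phi> itself.\<close>
    obtain r' where r': "?S < r'" "r' < r" using dense r by blast
    then have pos: "0 < r'" "0 < r" using S0 by auto
    let ?J = "{x \<in> orthant. \<phi> x \<le> 1}"
    have "convex ?J"
    proof -
      have "convex_on orthant \<phi>" using \<phi> by (simp add: Phi_def)
      then show ?thesis
        unfolding convex_def
      proof (intro ballI allI impI)
        fix x y :: "real \<times> real" and u v :: real
        assume *: "convex_on orthant \<phi>" "x \<in> ?J" "y \<in> ?J" "0 \<le> u" "0 \<le> v" "u + v = 1"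
        have "\<phi> (u *\<^sub>R x + v *\<^sub>R y) \<le> u * \<phi> x + v * \<phi> y"
          using * by (auto simp: convex_on_def)
        also have "\<dots> \<le> 1" using * by (intro convex_bound_le) auto
        finally show "u *\<^sub>R x + v *\<^sub>R y \<in> ?J"
          using * convexD[OF convex_orthant, of x y u v] by auto
      qed
    qed
    have "0 \<in> ?J" using \<phi> by (auto simp: Phi_def orthant_def)
    then have "0 \<in> closure ?J" by (rule subsetD[OF closure_subset])
    have "(a / r', b / r') \<in> closure ?J"
    proof (rule ccontr)
      assume "(a / r', b / r') \<notin> closure ?J"
      then obtain w where w: "1 < w \<bullet> (a / r', b / r')" "\<And>y. y \<in> closure ?J \<Longrightarrow> w \<bullet> y \<le> 1"
        using closed_convex_separate_le_1[OF closed_closure convex_closure[OF \<open>convex ?J\<close>] \<open>0 \<in> closure ?J\<close>]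
        by blast
      obtain w1 w2 where w12: "w = (w1, w2)" by (cases w)
      txt \<open>\<open>J\<^sub>\<phi>\<close> is symmetric about the axes, so the positive part of \<open>w\<close> is still in the polar.\<close>
      let ?p = "(max w1 0, max w2 0)"
      have "?p \<bullet> (y1, y2) \<le> 1" if "(y1, y2) \<in> orlicz_body \<phi>" for y1 y2
      proof -
        \<comment> \<open>Zeroing the coordinates where \<open>w\<close> is not positive stays in
          the sublevel set by monotonicity, and on the resulting point \<open>w\<close> agrees with
          its positive part.\<close>
        let ?y1 = "if w1 > 0 then \<bar>y1\<bar> else 0" and ?y2 = "if w2 > 0 then \<bar>y2\<bar> else 0"
        have "\<phi> (?y1, ?y2) \<le> \<phi> (\<bar>y1\<bar>, \<bar>y2\<bar>)"
          by (intro Phi_mono_Pair[OF \<phi>]) auto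
        also have "\<dots> \<le> 1" using that by (auto simp: orlicz_body_def)
        finally have "(?y1, ?y2) \<in> ?J" by (auto simp: orthant_Pair)
        then have "w \<bullet> (?y1, ?y2) \<le> 1" by (intro w(2) subsetD[OF closure_subset])
        moreover have "max w1 0 * y1 \<le> w1 * ?y1" "max w2 0 * y2 \<le> w2 * ?y2"
          by (auto simp: max_def intro: mult_left_mono)
        ultimately show ?thesis by (simp add: w12)
      qed
      then have "?p \<in> ?P" by (auto simp: polar_def orthant_Pair)
      then have "(a, b) \<bullet> ?p \<le> ?S" by (rule inner_le_support_fun[OF cP])
      moreover have "w1 * a \<le> max w1 0 * a" "w2 * b \<le> max w2 0 * b"
        using a b by (auto intro: mult_right_mono)
      moreover have "r' < w1 * a + w2 * b"
        using w(1) pos by (simp add: w12 field_simps)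
      ultimately have "r' < ?S" by (simp add: mult.commute)
      with r' show False by simp
    qed
    from closure_orlicz_body_scaled[OF \<phi> _ _ this, of "r' / r"] show ?thesis
      using pos r' by simp
  qed
  have "Inf ?R = ?S"
  proof (rule cInf_eq_non_empty)
    show "?R \<noteq> {}" using upper[of "?S + 1"] by auto
    show "?S \<le> r" if "r \<in> ?R" for r using lower that .
    show "y \<le> ?S" if "\<And>r. r \<in> ?R \<Longrightarrow> y \<le> r" for y
      by (rule dense_ge, rule that, rule upper)
  qed
  then show ?thesis ..
qed

section \<open>Weighted sums over a planar set of weights\<close>

text \<open>Known as the \<open>M\<close>-combination of \<open>K\<close> and \<open>L\<close>, with
  \<open>P\<close> in the role of \<open>M\<close>: the union of the Minkowski combinations of
  \<open>K\<close> and \<open>L\<close> with weights from \<open>P\<close>.\<close>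

definition weighted_sums :: "(real \<times> real) set \<Rightarrow> 'a::real_vector set \<Rightarrow> 'a set \<Rightarrow> 'a set" where
  "weighted_sums P K L = {u *\<^sub>R x + v *\<^sub>R y | u v x y. (u, v) \<in> P \<and> x \<in> K \<and> y \<in> L}"

lemma compact_weighted_sums:
  fixes K L :: "'a::real_normed_vector set"
  assumes "compact P" "compact K" "compact L"
  shows "compact (weighted_sums P K L)"
proof -
  have eq: "weighted_sums P K L =
      (\<lambda>(p, x, y). fst p *\<^sub>R x + snd p *\<^sub>R y) ` (P \<times> K \<times> L)"
    unfolding weighted_sums_def by force
  show ?thesis
    unfolding eq case_prod_unfold
    by (intro compact_continuous_image continuous_intros compact_Times assms)
qed

text \<open>Dividing the weights by their sum gives a convex combination. If the sum is 0, both
  weights vanish and any point of \<open>K\<close> serves.\<close>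

lemma convex_scaleR_combination:
  fixes K :: "'a::real_vector set"
  assumes "convex K" "x \<in> K" "x' \<in> K" "0 \<le> c" "0 \<le> c'"
  shows "\<exists>z\<in>K. c *\<^sub>R x + c' *\<^sub>R x' = (c + c') *\<^sub>R z"
proof (cases "c + c' = 0")
  case True
  with assms have "c = 0" "c' = 0" by auto
  with assms show ?thesis by auto
next
  case False
  then have pos: "0 < c + c'" using assms by auto
  have "(c / (c + c')) *\<^sub>R x + (c' / (c + c')) *\<^sub>R x' \<in> K"
    using pos assms by (intro convexD) (auto simp flip: add_divide_distrib)
  moreover have "c *\<^sub>R x + c' *\<^sub>R x' = (c + c') *\<^sub>R ((c / (c + c')) *\<^sub>R x + (c' / (c + c')) *\<^sub>R x')"
    using pos by (simp add: scaleR_add_right)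
  ultimately show ?thesis by blast
qed

text \<open>Mixing two elements mixes their weight pairs inside \<open>P\<close>. Nonnegative
  weights then let the two points of \<open>K\<close> merge into one, and likewise those of
  \<open>L\<close>.\<close>

lemma convex_weighted_sums:
  fixes K L :: "'a::real_vector set"
  assumes P: "convex P" "P \<subseteq> orthant" and K: "convex K" and L: "convex L"
  shows "convex (weighted_sums P K L)"
  unfolding convex_def
proof (intro ballI allI impI)
  fix m m' and s s' :: real
  assume "m \<in> weighted_sums P K L" "m' \<in> weighted_sums P K L" and s: "0 \<le> s" "0 \<le> s'" "s + s' = 1"
  then obtain u v x y u' v' x' y' where m: "m = u *\<^sub>R x + v *\<^sub>R y" "m' = u' *\<^sub>R x' + v' *\<^sub>R y'"
    and mem: "(u, v) \<in> P" "(u', v') \<in> P" "x \<in> K" "y \<in> L" "x' \<in> K" "y' \<in> L"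
    unfolding weighted_sums_def by blast
  have nn: "0 \<le> u" "0 \<le> v" "0 \<le> u'" "0 \<le> v'"
    using subsetD[OF P(2) mem(1)] subsetD[OF P(2) mem(2)] by (auto simp: orthant_Pair)
  obtain x'' where x'': "x'' \<in> K" "(s * u) *\<^sub>R x + (s' * u') *\<^sub>R x' = (s * u + s' * u') *\<^sub>R x''"
    using convex_scaleR_combination[OF K mem(3,5), of "s * u" "s' * u'"] s nn by auto
  obtain y'' where y'': "y'' \<in> L" "(s * v) *\<^sub>R y + (s' * v') *\<^sub>R y' = (s * v + s' * v') *\<^sub>R y''"
    using convex_scaleR_combination[OF L mem(4,6), of "s * v" "s' * v'"] s nn by auto
  have "s *\<^sub>R m + s' *\<^sub>R m' = (s * u + s' * u') *\<^sub>R x'' + (s * v + s' * v') *\<^sub>R y''"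
    unfolding x''(2)[symmetric] y''(2)[symmetric] by (simp add: m scaleR_add_right ac_simps)
  moreover have "(s * u + s' * u', s * v + s' * v') \<in> P"
    using convexD[OF P(1) mem(1,2) s] by simp
  ultimately show "s *\<^sub>R m + s' *\<^sub>R m' \<in> weighted_sums P K L"
    unfolding weighted_sums_def using x''(1) y''(1) by blast
qed

text \<open>For fixed nonnegative weights the maximisation splits into one over \<open>K\<close> and
  one over \<open>L\<close>; what remains is a linear maximisation over \<open>P\<close>.\<close>

lemma support_fun_weighted_sums:
  fixes K L :: "'a::euclidean_space set"
  assumes P: "compact P" "P \<noteq> {}" "P \<subseteq> orthant"
    and K: "compact K" "K \<noteq> {}" and L: "compact L" "L \<noteq> {}"
  shows "support_fun (weighted_sums P K L) z = support_fun P (support_fun K z, support_fun L z)"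
proof (rule antisym)
  show "support_fun (weighted_sums P K L) z \<le> support_fun P (support_fun K z, support_fun L z)"
    unfolding support_fun_def[of "weighted_sums P K L"]
  proof (rule cSUP_least)
    show "weighted_sums P K L \<noteq> {}"
      using P(2) K(2) L(2) unfolding weighted_sums_def by fastforce
    fix m assume "m \<in> weighted_sums P K L"
    then obtain u v x y where m: "m = u *\<^sub>R x + v *\<^sub>R y" "(u, v) \<in> P" "x \<in> K" "y \<in> L"
      unfolding weighted_sums_def by blast
    have "0 \<le> u" "0 \<le> v" using subsetD[OF P(3) m(2)] by (auto simp: orthant_Pair)
    then have "z \<bullet> m \<le> u * support_fun K z + v * support_fun L z"
      unfolding m(1) inner_add_right inner_scaleR_right
      by (intro add_mono mult_left_mono inner_le_support_fun K L m)
    also have "\<dots> = (support_fun K z, support_fun L z) \<bullet> (u, v)" by simp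
    also have "\<dots> \<le> support_fun P (support_fun K z, support_fun L z)"
      by (rule inner_le_support_fun[OF P(1) m(2)])
    finally show "z \<bullet> m \<le> support_fun P (support_fun K z, support_fun L z)" .
  qed
next
  obtain x where x: "x \<in> K" "support_fun K z = z \<bullet> x" using support_fun_attained[OF K] .
  obtain y where y: "y \<in> L" "support_fun L z = z \<bullet> y" using support_fun_attained[OF L] .
  obtain p where p: "p \<in> P"
    "support_fun P (support_fun K z, support_fun L z) = (support_fun K z, support_fun L z) \<bullet> p"
    using support_fun_attained[OF P(1,2)] .
  obtain u v where uv: "p = (u, v)" by (cases p)
  have "u *\<^sub>R x + v *\<^sub>R y \<in> weighted_sums P K L"
    using p(1) x(1) y(1) uv unfolding weighted_sums_def by blast
  from inner_le_support_fun[OF compact_weighted_sums[OF P(1) K(1) L(1)] this, of z]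
  show "support_fun P (support_fun K z, support_fun L z) \<le> support_fun (weighted_sums P K L) z"
    unfolding p(2) by (simp add: uv x y inner_add_right mult.commute)
qed

text \<open>The origin in \<open>K\<close> and \<open>L\<close> makes both support functions
  nonnegative, so the gauge formula applies to their values.\<close>

lemma is_orlicz_sum_weighted_sums:
  fixes K L :: "'a::euclidean_space set"
  assumes \<phi>: "\<phi> \<in> Phi"
    and K: "compact K" "convex K" "0 \<in> K" and L: "compact L" "convex L" "0 \<in> L"
  shows "is_orlicz_sum \<phi> K L (weighted_sums (polar (orlicz_body \<phi>) \<inter> orthant) K L)"
proof -
  let ?P = "polar (orlicz_body \<phi>) \<inter> orthant"
  have P: "compact ?P" by (rule compact_polar_orlicz_body[OF \<phi>])
  have P0: "(0, 0) \<in> ?P" by (auto simp: polar_def orthant_Pair)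
  have "weighted_sums ?P K L \<noteq> {}"
    using P0 K(3) L(3) unfolding weighted_sums_def by blast
  moreover have "support_fun (weighted_sums ?P K L) z =
      Inf {r. r > 0 \<and> \<phi> (support_fun K z / r, support_fun L z / r) \<le> 1}" for z
    using support_fun_weighted_sums[OF P _ _ K(1) _ L(1), of z] P0 K L
      support_fun_polar_orlicz_body[OF \<phi> support_fun_nonneg[OF K(1,3), of z]
        support_fun_nonneg[OF L(1,3), of z]]
    by fastforce
  ultimately show ?thesis
    unfolding is_orlicz_sum_def
    by (intro conjI allI compact_weighted_sums convex_weighted_sums convex_Int
        convex_polar convex_orthant P K L) auto
qed

section \<open>One-variable functions, their zero sets and restricted inverses\<close>

text \<open>Convexity gives continuity on the open half-line but does not exclude a jump at the
  endpoint 0; there \<psi> is squeezed between 0 and the identity.\<close>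

lemma continuous_on_Phi_real:
  fixes \<psi> :: "real \<Rightarrow> real"
  assumes \<psi>: "\<psi> \<in> Phi"
  shows "continuous_on {0..} \<psi>"
proof -
  have cvx: "convex_on {0..} \<psi>" and nn: "\<And>x. 0 \<le> x \<Longrightarrow> 0 \<le> \<psi> x"
    and v: "\<psi> 0 = 0" "\<psi> 1 = 1"
    using \<psi> by (auto simp: Phi_def orthant_real)
  have "continuous_on {0<..} \<psi>"
    by (rule convex_on_continuous) (auto intro: convex_on_subset[OF cvx])
  then have pos: "isCont \<psi> x" if "0 < x" for x
    using that by (simp add: continuous_on_eq_continuous_at)
  have "(\<psi> \<longlongrightarrow> 0) (at 0 within {0..})"
  proof (rule tendsto_sandwich[OF _ _ tendsto_const])
    show "\<forall>\<^sub>F x in at 0 within {0..}. 0 \<le> \<psi> x"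
      using nn by (auto simp: eventually_at_filter)
    show "\<forall>\<^sub>F x in at 0 within {0..}. \<psi> x \<le> x"
      unfolding eventually_at
    \<comment> \<open>Radius 1, because the upper bound comes from convexity between 0 and
      1.\<close>
    proof (intro exI[of _ 1] conjI ballI impI)
      fix x :: real assume "x \<in> {0..}" "x \<noteq> 0 \<and> dist x 0 < 1"
      then show "\<psi> x \<le> x"
        using Phi_le_scaleR[OF \<psi>, of 1 x] v by (auto simp: orthant_real)
    qed simp
    show "((\<lambda>x. x) \<longlongrightarrow> 0) (at (0::real) within {0..})" by (rule tendsto_ident_at)
  qed
  then have "continuous (at x within {0..}) \<psi>" if "0 \<le> x" for x
    using that pos[of x] v
    by (cases "x = 0") (auto simp: continuous_within intro: tendsto_within_subset)
  then show ?thesis by (simp add: continuous_on_eq_continuous_within)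
qed

lemma Phi_mono_real:
  fixes \<psi> :: "real \<Rightarrow> real"
  assumes \<psi>: "\<psi> \<in> Phi" and "0 \<le> x" "x \<le> y"
  shows "\<psi> x \<le> \<psi> y"
proof -
  have "\<psi> x \<le> \<psi> (x + s)" if "0 \<le> s" for s
    using \<psi> that assms(2) by (force simp: Phi_def orthant_real)
  from this[of "y - x"] show ?thesis using assms by simp
qed

text \<open>\<open>GREATEST\<close> is meaningful only once a maximum exists. Monotonicity and
  \<open>\<psi> 1 = 1\<close> keep all zeros below 1, and continuity makes the zero set in
  \<open>{0..1}\<close> compact.\<close>

lemma tau_Phi:
  assumes \<psi>: "\<psi> \<in> Phi"
  shows "0 \<le> tau \<psi>" "tau \<psi> < 1" "\<psi> (tau \<psi>) = 0" "\<And>t. tau \<psi> < t \<Longrightarrow> 0 < \<psi> t"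
proof -
  have nn: "\<And>x. 0 \<le> x \<Longrightarrow> 0 \<le> \<psi> x" and v: "\<psi> 0 = 0" "\<psi> 1 = 1"
    using \<psi> by (auto simp: Phi_def orthant_real)
  have lt1: "t < 1" if "\<psi> t = 0" for t
    using Phi_mono_real[OF \<psi>, of 1 t] v that by (cases "1 \<le> t") auto
  let ?Z = "{x \<in> {0..1}. \<psi> x = 0}"
  have "closed ?Z"
    by (intro continuous_closed_preimage_constant continuous_on_subset[OF continuous_on_Phi_real[OF \<psi>]]) auto
  then have "compact ({0..1} \<inter> ?Z)" by (intro compact_Int_closed) auto
  moreover have "0 \<in> {0..1} \<inter> ?Z" using v by simp
  ultimately obtain s where s: "s \<in> {0..1} \<inter> ?Z" "\<And>t. t \<in> {0..1} \<inter> ?Z \<Longrightarrow> t \<le> s"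
    using compact_attains_sup[of "{0..1} \<inter> ?Z"] by blast
  have max: "t \<le> s" if "0 \<le> t" "\<psi> t = 0" for t
    using s(2)[of t] that lt1[of t] by auto
  have tau: "tau \<psi> = s"
    unfolding tau_def using s(1) max by (intro Greatest_equality) auto
  show "0 \<le> tau \<psi>" "tau \<psi> < 1" "\<psi> (tau \<psi>) = 0" using s(1) lt1 by (auto simp: tau)
  show "0 < \<psi> t" if "tau \<psi> < t" for t
    using max[of t] nn[of t] that s(1) unfolding tau by fastforce
qed

text \<open>Convexity along the segment from 0 to \<open>y\<close> gives the factor
  \<open>x / y < 1\<close>, which is a strict gain because \<psi> is positive beyond
  \<open>tau \<psi>\<close>.\<close>

lemma Phi_strict_mono_real:
  assumes \<psi>: "\<psi> \<in> Phi" and "tau \<psi> \<le> x" "x < y"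
  shows "\<psi> x < \<psi> y"
proof -
  have x: "0 \<le> x" using tau_Phi(1)[OF \<psi>] assms by linarith
  have "\<psi> ((x / y) *\<^sub>R y) \<le> (x / y) * \<psi> y"
    using x assms by (intro Phi_le_scaleR[OF \<psi>]) (auto simp: orthant_real)
  also have "\<dots> < 1 * \<psi> y"
    using x assms by (intro mult_strict_right_mono tau_Phi(4)[OF \<psi>]) auto
  finally show ?thesis using x assms by simp
qed

text \<open>The intermediate value theorem makes \<open>inv_into\<close> a genuine right inverse. By
  strict monotonicity its value is the largest point of the sublevel set at \<open>c\<close>, which
  is the form needed for domination by the arc.\<close>

lemma psi_hat_inv_Phi:
  assumes \<psi>: "\<psi> \<in> Phi" and c: "0 \<le> c" "c \<le> 1"
  shows "psi_hat_inv \<psi> c \<in> {0..1}" "\<psi> (psi_hat_inv \<psi> c) = c"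
    and "\<And>u. \<psi> u \<le> c \<Longrightarrow> u \<le> psi_hat_inv \<psi> c"
proof -
  have v: "\<psi> 1 = 1" using \<psi> by (auto simp: Phi_def)
  have "\<exists>x\<ge>tau \<psi>. x \<le> 1 \<and> \<psi> x = c"
    using tau_Phi[OF \<psi>] c v
    by (intro IVT' continuous_on_subset[OF continuous_on_Phi_real[OF \<psi>]]) auto
  then have c': "c \<in> \<psi> ` {tau \<psi>..1}" by auto
  have mem: "psi_hat_inv \<psi> c \<in> {tau \<psi>..1}"
    unfolding psi_hat_inv_def by (rule inv_into_into[OF c'])
  then show "psi_hat_inv \<psi> c \<in> {0..1}" using tau_Phi(1)[OF \<psi>] by auto
  show val: "\<psi> (psi_hat_inv \<psi> c) = c"
    unfolding psi_hat_inv_def by (rule f_inv_into_f[OF c'])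
  show "u \<le> psi_hat_inv \<psi> c" if "\<psi> u \<le> c" for u
    using Phi_strict_mono_real[OF \<psi>, of "psi_hat_inv \<psi> c" u] mem val that by fastforce
qed

section \<open>From the boundary arc to the full set of weights\<close>

text \<open>The surplus weight \<open>p - u\<close> is assigned to the origin, so a larger weight
  can always replace a smaller one.\<close>

lemma scaleR_shrink:
  fixes K :: "'a::real_vector set"
  assumes "convex K" "0 \<in> K" "x \<in> K" "0 \<le> u" "u \<le> p"
  shows "\<exists>x'\<in>K. u *\<^sub>R x = p *\<^sub>R x'"
  using convex_scaleR_combination[OF assms(1,3,2), of u "p - u"] assms by auto

lemma psi_hat_inv_sums_eq:
  fixes K L :: "'a::real_vector set"
  assumes \<psi>: "\<psi>1 \<in> Phi" "\<psi>2 \<in> Phi"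
    and K: "convex K" "0 \<in> K" and L: "convex L" "0 \<in> L"
  shows "{psi_hat_inv \<psi>1 (1 - t) *\<^sub>R x + psi_hat_inv \<psi>2 t *\<^sub>R y | x y t.
            x \<in> K \<and> y \<in> L \<and> 0 \<le> t \<and> t \<le> 1} =
         weighted_sums {(x1, x2). x1 \<in> {0..1} \<and> x2 \<in> {0..1} \<and> \<psi>1 x1 + \<psi>2 x2 \<le> 1} K L"
    (is "?A = weighted_sums ?P K L")
proof (intro antisym subsetI)
  fix m assume "m \<in> ?A"
  then obtain x y t where m: "m = psi_hat_inv \<psi>1 (1 - t) *\<^sub>R x + psi_hat_inv \<psi>2 t *\<^sub>R y"
    and mem: "x \<in> K" "y \<in> L" and t: "0 \<le> t" "t \<le> 1" by blast
  have "(psi_hat_inv \<psi>1 (1 - t), psi_hat_inv \<psi>2 t) \<in> ?P"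
    using psi_hat_inv_Phi[OF \<psi>(1), of "1 - t"] psi_hat_inv_Phi[OF \<psi>(2), of t] t by auto
  then show "m \<in> weighted_sums ?P K L"
    unfolding weighted_sums_def using m mem by blast
next
  fix m assume "m \<in> weighted_sums ?P K L"
  then obtain u v x y where m: "m = u *\<^sub>R x + v *\<^sub>R y" and uv: "(u, v) \<in> ?P"
    and mem: "x \<in> K" "y \<in> L"
    unfolding weighted_sums_def by blast
  \<comment> \<open>This \<open>t\<close> selects an arc point dominating \<open>(u, v)\<close>: the
    constraint of \<open>P\<close> becomes \<open>\<psi>1 u \<le> 1 - t\<close>, so each weight is
    at most the matching inverse value.\<close>
  define t where "t = \<psi>2 v"
  have nn: "0 \<le> \<psi>1 u" "0 \<le> \<psi>2 v" using uv \<psi> by (auto simp: Phi_def orthant_real)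
  then have t: "0 \<le> t" "t \<le> 1" "\<psi>1 u \<le> 1 - t" using uv by (auto simp: t_def)
  have "u \<le> psi_hat_inv \<psi>1 (1 - t)" "v \<le> psi_hat_inv \<psi>2 t"
    using psi_hat_inv_Phi(3)[OF \<psi>(1), of "1 - t" u] psi_hat_inv_Phi(3)[OF \<psi>(2), of t v] t
    by (auto simp: t_def)
  moreover have "0 \<le> u" "0 \<le> v" using uv by auto
  ultimately obtain x' y' where x': "x' \<in> K" "u *\<^sub>R x = psi_hat_inv \<psi>1 (1 - t) *\<^sub>R x'"
    and y': "y' \<in> L" "v *\<^sub>R y = psi_hat_inv \<psi>2 t *\<^sub>R y'"
    using scaleR_shrink[OF K mem(1)] scaleR_shrink[OF L mem(2)] by meson
  have "m = psi_hat_inv \<psi>1 (1 - t) *\<^sub>R x' + psi_hat_inv \<psi>2 t *\<^sub>R y'"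
    unfolding m x'(2) y'(2) ..
  with x'(1) y'(1) t show "m \<in> ?A" by blast
qed

theorem theorem6p1:
  fixes \<phi> :: "real \<times> real \<Rightarrow> real"
    and \<psi>1 \<psi>2 :: "real \<Rightarrow> real"
    and K L :: "(real ^ 'n) set"
  assumes "CARD('n) \<ge> 2"
    and "\<phi> \<in> Phi"
    and "polar (orlicz_body \<phi>) \<noteq> {-1..1} \<times> {-1..1}"
    and "\<psi>1 \<in> Phi" and "\<psi>2 \<in> Phi"
    and "polar (orlicz_body \<phi>) \<inter> orthant =
           {(x1, x2). x1 \<in> {0..1} \<and> x2 \<in> {0..1} \<and> \<psi>1 x1 + \<psi>2 x2 \<le> 1}"
    and "compact K" and "convex K" and "0 \<in> K"
    and "compact L" and "convex L" and "0 \<in> L"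
  shows "is_orlicz_sum \<phi> K L (orlicz_sum \<phi> K L) \<and>
         {psi_hat_inv \<psi>1 (1 - t) *\<^sub>R x + psi_hat_inv \<psi>2 t *\<^sub>R y | x y t.
            x \<in> K \<and> y \<in> L \<and> 0 \<le> t \<and> t \<le> 1} = orlicz_sum \<phi> K L"
proof -
  have "is_orlicz_sum \<phi> K L (weighted_sums (polar (orlicz_body \<phi>) \<inter> orthant) K L)"
    by (rule is_orlicz_sum_weighted_sums) (fact assms)+
  \<comment> \<open>The same witness proves that the description is satisfied and evaluates
    it.\<close>
  moreover from orlicz_sum_eqI[OF this]
  have "orlicz_sum \<phi> K L = weighted_sums (polar (orlicz_body \<phi>) \<inter> orthant) K L" .
  moreover note psi_hat_inv_sums_eq[OF assms(4,5,8,9,11,12)]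
  ultimately show ?thesis unfolding assms(6) by simp
qed

end
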